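(* Let $\phi:\mathbb{U}\to\mathbb{U}$ be analytic and let $\psi$ be analytic on $\mathbb{U}$ such that $W_{\psi,\phi}$ is bounded on $H^2(\mathbb{U})$. Suppose that $\phi$ has a fixed point $p\in\mathbb{U}$. Then $W_{\psi,\phi}$ is normal on $H^2(\mathbb{U})$ if and only if $$\psi=\gamma\,\frac{K_p}{K_p\circ\phi}\quad\text{and}\quad \phi=\alpha_p\circ(\delta\alpha_p),$$ where $\alpha_p(z)=(p-z)/(1-\bar p z)$ and $\delta$ is a constant satisfying $|\delta|\le 1$, while $\gamma$ is a constant giving the value of $\psi$ at $p$.
   Context: $\mathbb{U}$ is the open unit disc in $\mathbb{C}$. $H^2(\mathbb{U})$ is the Hardy space of analytic functions on $\mathbb{U}$ with square-summable Maclaurin coefficients, a Hilbert space with inner product $\langle f,g\rangle=\sum_{n\ge 0}\hat f(n)\overline{\hat g(n)}$, where $\hat f(n)$ and $\hat g(n)$ are the Maclaurin coefficients of $f$ and $g$. The weighted composition operator is $W_{\psi,\phi}f=\psi\cdot(f\circ\phi)$. For $p\in\mathbb{U}$, $K_p(z)=1/(1-\bar p z)$ is the reproducing kernel of $H^2(\mathbb{U})$ at $p$. Here $\delta\alpha_p$ denotes the function $z\mapsto\delta\cdot\alpha_p(z)$.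
   Formalization: The formal theorem assumes in addition that ψ is not identically zero on the disc; for ψ = 0 the operator is zero, hence normal for every φ (e.g. φ(z) = z², p = 0), and the claimed form of φ fails. *)

theory Defs
  imports "HOL-Complex_Analysis.Complex_Analysis"
begin

abbreviation unit_disc :: "complex set" where
  "unit_disc \<equiv> ball 0 1"

definition maclaurin_coeff :: "(complex \<Rightarrow> complex) \<Rightarrow> nat \<Rightarrow> complex" where
  "maclaurin_coeff f n = fps_nth (fps_expansion f 0) n"

(* Functions on the disc are represented by total functions vanishing off the disc, so that
   equality of elements of the Hardy space is HOL equality. *)
definition hardy2 :: "(complex \<Rightarrow> complex) set" where
  "hardy2 = {f. f holomorphic_on unit_disc \<and> (\<forall>z. z \<notin> unit_disc \<longrightarrow> f z = 0) \<and>
                summable (\<lambda>n. (cmod (maclaurin_coeff f n))\<^sup>2)}"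

definition hardy2_inner :: "(complex \<Rightarrow> complex) \<Rightarrow> (complex \<Rightarrow> complex) \<Rightarrow> complex" where
  "hardy2_inner f g = (\<Sum>n. maclaurin_coeff f n * cnj (maclaurin_coeff g n))"

definition hardy2_norm :: "(complex \<Rightarrow> complex) \<Rightarrow> real" where
  "hardy2_norm f = sqrt (Re (hardy2_inner f f))"

definition hardy2_bounded :: "((complex \<Rightarrow> complex) \<Rightarrow> (complex \<Rightarrow> complex)) \<Rightarrow> bool" where
  "hardy2_bounded T \<longleftrightarrow>
     (\<forall>f\<in>hardy2. T f \<in> hardy2) \<and>
     (\<forall>f\<in>hardy2. \<forall>g\<in>hardy2. T (\<lambda>z. f z + g z) = (\<lambda>z. T f z + T g z)) \<and>
     (\<forall>c. \<forall>f\<in>hardy2. T (\<lambda>z. c * f z) = (\<lambda>z. c * T f z)) \<and>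
     (\<exists>C. \<forall>f\<in>hardy2. hardy2_norm (T f) \<le> C * hardy2_norm f)"

definition hardy2_is_adjoint ::
  "((complex \<Rightarrow> complex) \<Rightarrow> (complex \<Rightarrow> complex)) \<Rightarrow>
   ((complex \<Rightarrow> complex) \<Rightarrow> (complex \<Rightarrow> complex)) \<Rightarrow> bool" where
  "hardy2_is_adjoint T S \<longleftrightarrow>
     (\<forall>g\<in>hardy2. S g \<in> hardy2) \<and>
     (\<forall>f\<in>hardy2. \<forall>g\<in>hardy2. hardy2_inner (T f) g = hardy2_inner f (S g))"

(* A bounded operator has exactly one adjoint on hardy2, so S below is the adjoint of T. *)
definition hardy2_normal :: "((complex \<Rightarrow> complex) \<Rightarrow> (complex \<Rightarrow> complex)) \<Rightarrow> bool" where
  "hardy2_normal T \<longleftrightarrow>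
     hardy2_bounded T \<and>
     (\<exists>S. hardy2_is_adjoint T S \<and> (\<forall>f\<in>hardy2. T (S f) = S (T f)))"

definition weighted_comp ::
  "(complex \<Rightarrow> complex) \<Rightarrow> (complex \<Rightarrow> complex) \<Rightarrow> (complex \<Rightarrow> complex) \<Rightarrow> (complex \<Rightarrow> complex)" where
  "weighted_comp \<psi> \<phi> f = (\<lambda>z. if z \<in> unit_disc then \<psi> z * f (\<phi> z) else 0)"

definition szego_kernel :: "complex \<Rightarrow> complex \<Rightarrow> complex" where
  "szego_kernel p z = 1 / (1 - cnj p * z)"

definition disc_involution :: "complex \<Rightarrow> complex \<Rightarrow> complex" where
  "disc_involution p z = (p - z) / (1 - cnj p * z)"

end

theory Submission
  imports Defs
begin

text \<open>Write T for the weighted composition operator. The adjoint of T preserves the span of the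
  kernels at p for evaluation and for differentiation, because p is fixed, and it has eigenvectors
  \<open>K\<^sub>p\<close> and \<open>K\<^sub>p \<alpha>\<^sub>p\<close> there. If T is normal these are eigenvectors of T for the conjugate
  eigenvalues; the first eigenvalue equation determines \<open>\<psi>\<close>, and the second then says that
  \<open>\<alpha>\<^sub>p \<circ> \<phi> = \<delta> \<alpha>\<^sub>p\<close> with \<open>\<delta> = \<phi>'(p)\<close>.

  Conversely, if \<open>\<psi>\<close> and \<open>\<phi>\<close> have the stated form, T maps each kernel to a multiple of a kernel,
  so its adjoint is again a weighted composition operator, of the same form with \<open>\<gamma>\<close> and \<open>\<delta>\<close>
  conjugated; two operators of this form with the same p commute.\<close>

section \<open>Coefficients and the inner product\<close>

lemma maclaurin_coeff_sums:
  assumes "f holomorphic_on unit_disc" "z \<in> unit_disc"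
  shows "(\<lambda>n. maclaurin_coeff f n * z ^ n) sums f z"
  using holomorphic_power_series[OF assms] by (simp add: maclaurin_coeff_def fps_expansion_def)

lemma conv_radius_ge_1:
  fixes b :: "nat \<Rightarrow> complex"
  assumes "\<And>z. z \<in> unit_disc \<Longrightarrow> summable (\<lambda>n. b n * z ^ n)"
  shows "conv_radius b \<ge> 1"
proof (rule conv_radius_geI_ex')
  fix r :: real assume "0 < r" "ereal r < 1"
  then show "summable (\<lambda>n. b n * of_real r ^ n)" by (intro assms) simp
qed

text \<open>Uniqueness of the expansion. Pointwise convergence on the disc forces a radius of
  convergence of at least 1, and inside that radius the sum is holomorphic with the given
  coefficients.\<close>

lemma power_series_maclaurin_coeff:
  assumes "\<And>z. z \<in> unit_disc \<Longrightarrow> (\<lambda>n. b n * z ^ n) sums f z"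
  shows "maclaurin_coeff f = b" "f holomorphic_on unit_disc"
proof -
  have r: "conv_radius b \<ge> 1"
    using assms by (intro conv_radius_ge_1) (auto simp: sums_iff)
  have e: "eval_fps (Abs_fps b) z = f z" if "z \<in> unit_disc" for z
    using assms[OF that] by (simp add: eval_fps_def sums_iff)
  have r': "fps_conv_radius (Abs_fps b) \<ge> 1"
    using r by (simp add: fps_conv_radius_def)
  have "eventually (\<lambda>z. z \<in> unit_disc) (nhds 0)"
    by (rule eventually_nhds_in_open) auto
  then have "eventually (\<lambda>z. eval_fps (Abs_fps b) z = f z) (nhds 0)"
    by eventually_elim (rule e)
  moreover have "fps_conv_radius (Abs_fps b) > 0"
    using r' by (rule less_le_trans[rotated]) simp
  ultimately have "f has_fps_expansion Abs_fps b"
    by (simp add: has_fps_expansion_def)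
  then show "maclaurin_coeff f = b"
    by (auto simp: maclaurin_coeff_def fps_expansion_eqI)
  have "eval_fps (Abs_fps b) holomorphic_on unit_disc"
  proof (rule holomorphic_on_eval_fps, rule subsetI)
    fix z :: complex assume "z \<in> unit_disc"
    then have "ereal (norm z) < 1" by simp
    also note r'
    finally show "z \<in> eball 0 (fps_conv_radius (Abs_fps b))" by (simp add: in_eball_iff)
  qed
  then show "f holomorphic_on unit_disc"
    by (rule holomorphic_transform) (rule e)
qed

section \<open>Square-summable sequences and the functions they define\<close>

lemma summable_norm_mult_square_summable:
  fixes a b :: "nat \<Rightarrow> complex"
  assumes "summable (\<lambda>n. (cmod (a n))\<^sup>2)" "summable (\<lambda>n. (cmod (b n))\<^sup>2)"
  shows "summable (\<lambda>n. cmod (a n) * cmod (b n))"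
proof (rule summable_comparison_test'[OF summable_add[OF assms]])
  fix n
  have "2 * (cmod (a n) * cmod (b n)) \<le> (cmod (a n))\<^sup>2 + (cmod (b n))\<^sup>2"
    using sum_squares_bound[of "cmod (a n)" "cmod (b n)"] by simp
  moreover have "0 \<le> cmod (a n) * cmod (b n)" by simp
  ultimately have "cmod (a n) * cmod (b n) \<le> (cmod (a n))\<^sup>2 + (cmod (b n))\<^sup>2"
    by linarith
  then show "norm (cmod (a n) * cmod (b n)) \<le> (cmod (a n))\<^sup>2 + (cmod (b n))\<^sup>2"
    by simp
qed

lemma square_summable_add:
  fixes a b :: "nat \<Rightarrow> complex"
  assumes "summable (\<lambda>n. (cmod (a n))\<^sup>2)" "summable (\<lambda>n. (cmod (b n))\<^sup>2)"
  shows "summable (\<lambda>n. (cmod (a n + b n))\<^sup>2)"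
proof (rule summable_comparison_test'[OF summable_mult[OF summable_add[OF assms], of 2]])
  fix n
  have "(cmod (a n + b n))\<^sup>2 \<le> (cmod (a n) + cmod (b n))\<^sup>2"
    by (intro power_mono norm_triangle_ineq) simp
  also have "\<dots> \<le> 2 * ((cmod (a n))\<^sup>2 + (cmod (b n))\<^sup>2)"
    using sum_squares_bound[of "cmod (a n)" "cmod (b n)"] by (simp add: power2_sum)
  finally show "norm ((cmod (a n + b n))\<^sup>2) \<le> 2 * ((cmod (a n))\<^sup>2 + (cmod (b n))\<^sup>2)" by simp
qed

lemma square_summable_geometric:
  fixes z :: complex
  assumes "z \<in> unit_disc"
  shows "summable (\<lambda>n. (cmod (z ^ n))\<^sup>2)"
proof -
  have "summable (\<lambda>n. ((cmod z)\<^sup>2) ^ n)"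
    using assms by (intro summable_geometric) (simp add: power_less_one_iff abs_square_less_1)
  then show ?thesis by (simp add: norm_power power_mult[symmetric] mult.commute)
qed

lemma square_summable_power_series:
  fixes b :: "nat \<Rightarrow> complex"
  assumes "summable (\<lambda>n. (cmod (b n))\<^sup>2)" "z \<in> unit_disc"
  shows "summable (\<lambda>n. b n * z ^ n)"
proof (rule summable_norm_cancel)
  show "summable (\<lambda>n. norm (b n * z ^ n))"
    using summable_norm_mult_square_summable[OF assms(1) square_summable_geometric[OF assms(2)]]
    by (simp add: norm_mult)
qed

text \<open>Inverse of \<open>maclaurin_coeff\<close> between square-summable sequences and
  \<open>hardy2\<close>. Building elements this way yields membership and coefficients
  together.\<close>

definition hardy2_of_coeffs :: "(nat \<Rightarrow> complex) \<Rightarrow> complex \<Rightarrow> complex" where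
  "hardy2_of_coeffs b z = (if z \<in> unit_disc then \<Sum>n. b n * z ^ n else 0)"

lemma hardy2_of_coeffs_outside: "z \<notin> unit_disc \<Longrightarrow> hardy2_of_coeffs b z = 0"
  by (simp add: hardy2_of_coeffs_def)

lemma
  assumes "summable (\<lambda>n. (cmod (b n))\<^sup>2)"
  shows hardy2_of_coeffs_in: "hardy2_of_coeffs b \<in> hardy2"
    and maclaurin_coeff_of_coeffs: "maclaurin_coeff (hardy2_of_coeffs b) = b"
proof -
  have s: "(\<lambda>n. b n * z ^ n) sums hardy2_of_coeffs b z" if "z \<in> unit_disc" for z
    using square_summable_power_series[OF assms that] that
    by (simp add: hardy2_of_coeffs_def sums_iff)
  show "maclaurin_coeff (hardy2_of_coeffs b) = b"
    by (rule power_series_maclaurin_coeff(1)) (rule s)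
  moreover have "hardy2_of_coeffs b holomorphic_on unit_disc"
    by (rule power_series_maclaurin_coeff(2)) (rule s)
  ultimately show "hardy2_of_coeffs b \<in> hardy2"
    using assms hardy2_of_coeffs_outside by (simp add: hardy2_def)
qed

lemma hardy2D:
  assumes "f \<in> hardy2"
  shows "f holomorphic_on unit_disc" "z \<notin> unit_disc \<Longrightarrow> f z = 0"
    "summable (\<lambda>n. (cmod (maclaurin_coeff f n))\<^sup>2)"
  using assms by (auto simp: hardy2_def)

lemma hardy2_of_coeffs_maclaurin_coeff:
  assumes "f \<in> hardy2"
  shows "hardy2_of_coeffs (maclaurin_coeff f) = f"
proof
  fix z show "hardy2_of_coeffs (maclaurin_coeff f) z = f z"
    using maclaurin_coeff_sums[OF hardy2D(1)[OF assms], of z] hardy2D(2)[OF assms, of z]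
    by (auto simp: hardy2_of_coeffs_def sums_iff)
qed

lemma hardy2_of_coeffs_add:
  assumes "summable (\<lambda>n. (cmod (a n))\<^sup>2)" "summable (\<lambda>n. (cmod (b n))\<^sup>2)"
  shows "hardy2_of_coeffs (\<lambda>n. a n + b n) = (\<lambda>z. hardy2_of_coeffs a z + hardy2_of_coeffs b z)"
  using square_summable_power_series[OF assms(1)] square_summable_power_series[OF assms(2)]
  by (auto simp: fun_eq_iff hardy2_of_coeffs_def distrib_right suminf_add)

lemma hardy2_of_coeffs_mult:
  assumes "summable (\<lambda>n. (cmod (a n))\<^sup>2)"
  shows "hardy2_of_coeffs (\<lambda>n. c * a n) = (\<lambda>z. c * hardy2_of_coeffs a z)"
  using square_summable_power_series[OF assms(1)]
  by (auto simp: fun_eq_iff hardy2_of_coeffs_def mult.assoc suminf_mult)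

lemma
  assumes "f \<in> hardy2" "g \<in> hardy2"
  shows hardy2_add: "(\<lambda>z. f z + g z) \<in> hardy2"
    and maclaurin_coeff_add:
      "maclaurin_coeff (\<lambda>z. f z + g z) = (\<lambda>n. maclaurin_coeff f n + maclaurin_coeff g n)"
proof -
  note s = hardy2D(3)[OF assms(1)] hardy2D(3)[OF assms(2)]
  have "(\<lambda>z. f z + g z) = hardy2_of_coeffs (\<lambda>n. maclaurin_coeff f n + maclaurin_coeff g n)"
    by (simp add: hardy2_of_coeffs_add[OF s] hardy2_of_coeffs_maclaurin_coeff assms)
  then show "(\<lambda>z. f z + g z) \<in> hardy2"
    "maclaurin_coeff (\<lambda>z. f z + g z) = (\<lambda>n. maclaurin_coeff f n + maclaurin_coeff g n)"
    using hardy2_of_coeffs_in[OF square_summable_add[OF s]]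
      maclaurin_coeff_of_coeffs[OF square_summable_add[OF s]] by simp_all
qed

lemma
  assumes "f \<in> hardy2"
  shows hardy2_mult: "(\<lambda>z. c * f z) \<in> hardy2"
    and maclaurin_coeff_mult:
      "maclaurin_coeff (\<lambda>z. c * f z) = (\<lambda>n. c * maclaurin_coeff f n)"
proof -
  note s = hardy2D(3)[OF assms(1)]
  have e: "(\<lambda>z. c * f z) = hardy2_of_coeffs (\<lambda>n. c * maclaurin_coeff f n)"
    by (simp add: hardy2_of_coeffs_mult[OF s] hardy2_of_coeffs_maclaurin_coeff assms)
  have s': "summable (\<lambda>n. (cmod (c * maclaurin_coeff f n))\<^sup>2)"
    using summable_mult[OF s, of "(cmod c)\<^sup>2"] by (simp add: norm_mult power_mult_distrib)
  show "(\<lambda>z. c * f z) \<in> hardy2"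
    "maclaurin_coeff (\<lambda>z. c * f z) = (\<lambda>n. c * maclaurin_coeff f n)"
    using hardy2_of_coeffs_in[OF s'] maclaurin_coeff_of_coeffs[OF s'] e by simp_all
qed

section \<open>Inner product and norm\<close>

lemma summable_hardy2_inner:
  assumes "f \<in> hardy2" "g \<in> hardy2"
  shows "summable (\<lambda>n. maclaurin_coeff f n * cnj (maclaurin_coeff g n))"
  by (rule summable_norm_cancel)
    (use summable_norm_mult_square_summable[OF hardy2D(3)[OF assms(1)] hardy2D(3)[OF assms(2)]]
      in \<open>simp add: norm_mult\<close>)

lemma hardy2_inner_add_left:
  assumes "f \<in> hardy2" "g \<in> hardy2" "h \<in> hardy2"
  shows "hardy2_inner (\<lambda>z. f z + g z) h = hardy2_inner f h + hardy2_inner g h"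
  using assms
  by (simp add: hardy2_inner_def maclaurin_coeff_add distrib_right suminf_add summable_hardy2_inner)

lemma hardy2_inner_mult_left:
  assumes "f \<in> hardy2" "h \<in> hardy2"
  shows "hardy2_inner (\<lambda>z. c * f z) h = c * hardy2_inner f h"
  using assms
  by (simp add: hardy2_inner_def maclaurin_coeff_mult mult.assoc suminf_mult summable_hardy2_inner)

lemma hardy2_inner_commute:
  assumes "f \<in> hardy2" "g \<in> hardy2"
  shows "hardy2_inner g f = cnj (hardy2_inner f g)"
proof -
  have "(\<lambda>n. cnj (maclaurin_coeff f n * cnj (maclaurin_coeff g n))) sums cnj (hardy2_inner f g)"
    unfolding hardy2_inner_def sums_cnj
    using summable_hardy2_inner[OF assms] by (rule summable_sums)
  then show ?thesis
    by (simp add: hardy2_inner_def sums_iff mult.commute)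
qed

lemma hardy2_inner_add_right:
  assumes "f \<in> hardy2" "g \<in> hardy2" "h \<in> hardy2"
  shows "hardy2_inner h (\<lambda>z. f z + g z) = hardy2_inner h f + hardy2_inner h g"
  using assms hardy2_add[OF assms(1,2)]
  by (simp add: hardy2_inner_commute[of _ h] hardy2_inner_add_left)

lemma hardy2_inner_mult_right:
  assumes "f \<in> hardy2" "h \<in> hardy2"
  shows "hardy2_inner h (\<lambda>z. c * f z) = cnj c * hardy2_inner h f"
  using assms hardy2_mult[OF assms(1)]
  by (simp add: hardy2_inner_commute[of _ h] hardy2_inner_mult_left)

lemma hardy2_norm_eq:
  assumes "f \<in> hardy2"
  shows "hardy2_norm f = sqrt (\<Sum>n. (cmod (maclaurin_coeff f n))\<^sup>2)"
proof -
  have "hardy2_inner f f = complex_of_real (\<Sum>n. (cmod (maclaurin_coeff f n))\<^sup>2)"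
    using hardy2D(3)[OF assms]
    by (simp add: hardy2_inner_def suminf_of_real flip: complex_norm_square)
  then show ?thesis by (simp add: hardy2_norm_def)
qed

lemma hardy2_norm_nonneg: "f \<in> hardy2 \<Longrightarrow> 0 \<le> hardy2_norm f"
  by (simp add: hardy2_norm_eq suminf_nonneg hardy2D)

lemma hardy2_inner_self_eq_0:
  assumes "f \<in> hardy2" "hardy2_inner f f = 0"
  shows "f = (\<lambda>z. 0)"
proof -
  have "(\<Sum>n. (cmod (maclaurin_coeff f n))\<^sup>2) = 0"
    using hardy2_norm_eq[OF assms(1)] assms(2) by (simp add: hardy2_norm_def)
  then have "maclaurin_coeff f n = 0" for n
    using suminf_eq_zero_iff[OF hardy2D(3)[OF assms(1)]] by simp
  then have "hardy2_of_coeffs (maclaurin_coeff f) = (\<lambda>z. 0)"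
    by (simp add: hardy2_of_coeffs_def fun_eq_iff)
  then show ?thesis
    by (simp add: hardy2_of_coeffs_maclaurin_coeff[OF assms(1)])
qed

text \<open>The finite inequality bounds every partial sum of the products of moduli by the product
  of the norms, so the bound passes to the series.\<close>

lemma hardy2_Cauchy_Schwarz:
  assumes "f \<in> hardy2" "g \<in> hardy2"
  shows "cmod (hardy2_inner f g) \<le> hardy2_norm f * hardy2_norm g"
proof -
  let ?a = "maclaurin_coeff f" and ?b = "maclaurin_coeff g"
  note s = summable_norm_mult_square_summable[OF hardy2D(3)[OF assms(1)] hardy2D(3)[OF assms(2)]]
  have L: "L2_set (\<lambda>n. cmod (maclaurin_coeff h n)) {..<N} \<le> hardy2_norm h" if "h \<in> hardy2" for h N
    using hardy2D(3)[OF that]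
    by (auto simp: L2_set_def hardy2_norm_eq[OF that] intro!: sum_le_suminf)
  have "cmod (hardy2_inner f g) \<le> (\<Sum>n. cmod (?a n) * cmod (?b n))"
    using summable_norm[of "\<lambda>n. ?a n * cnj (?b n)"] s by (simp add: hardy2_inner_def norm_mult)
  also have "\<dots> \<le> hardy2_norm f * hardy2_norm g"
  proof (rule suminf_le_const[OF s])
    fix N
    have "(\<Sum>n<N. cmod (?a n) * cmod (?b n))
        \<le> L2_set (\<lambda>n. cmod (?a n)) {..<N} * L2_set (\<lambda>n. cmod (?b n)) {..<N}"
      using L2_set_mult_ineq[of "\<lambda>n. cmod (?a n)" "\<lambda>n. cmod (?b n)" "{..<N}"] by simp
    also have "\<dots> \<le> hardy2_norm f * hardy2_norm g"
      by (intro mult_mono L assms hardy2_norm_nonneg L2_set_nonneg)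
    finally show "(\<Sum>n<N. cmod (?a n) * cmod (?b n)) \<le> hardy2_norm f * hardy2_norm g" .
  qed
  finally show ?thesis .
qed

lemma hardy2_eqI:
  assumes "f \<in> hardy2" "g \<in> hardy2" "\<And>h. h \<in> hardy2 \<Longrightarrow> hardy2_inner h f = hardy2_inner h g"
  shows "f = g"
proof -
  \<comment> \<open>The difference serves as its own test function. It is written as a sum with a
    scalar multiple so that the additivity and homogeneity lemmas apply as they stand.\<close>
  let ?d = "\<lambda>z. f z + (-1) * g z"
  have g: "(\<lambda>z. (-1) * g z) \<in> hardy2" by (rule hardy2_mult[OF assms(2)])
  have d: "?d \<in> hardy2" by (rule hardy2_add[OF assms(1) g])
  have "hardy2_inner ?d ?d = 0"
    using hardy2_inner_add_right[OF assms(1) g d] hardy2_inner_mult_right[OF assms(2) d, of "-1"]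
      assms(3)[OF d] by simp
  from hardy2_inner_self_eq_0[OF d this] show ?thesis
    by (simp add: fun_eq_iff)
qed

section \<open>Reproducing kernels\<close>

text \<open>The Szego kernel cut off outside the disc, hence an element of \<open>hardy2\<close>.
  With its coefficients as the definition, pairing a function with it gives the power series of that
  function at \<open>p\<close>.\<close>

definition hardy2_kernel :: "complex \<Rightarrow> complex \<Rightarrow> complex" where
  "hardy2_kernel p = hardy2_of_coeffs (\<lambda>n. cnj p ^ n)"

text \<open>Represents the derivative at \<open>p\<close>: the conjugated coefficients are the
  factors of the termwise differentiated series. At n = 0 the truncated exponent is harmless, as the
  factor n vanishes.\<close>

definition hardy2_deriv_kernel :: "complex \<Rightarrow> complex \<Rightarrow> complex" where
  "hardy2_deriv_kernel p = hardy2_of_coeffs (\<lambda>n. of_nat n * cnj p ^ (n - 1))"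

lemma cnj_mult_in_unit_disc:
  assumes "p \<in> unit_disc" "z \<in> unit_disc"
  shows "cnj p * z \<in> unit_disc"
proof -
  have "cmod p * cmod z \<le> 1 * cmod z"
    using assms by (intro mult_right_mono) auto
  then show ?thesis using assms by (simp add: norm_mult)
qed

lemma one_minus_cnj_mult_neq_0:
  assumes "p \<in> unit_disc" "z \<in> unit_disc"
  shows "1 - cnj p * z \<noteq> 0"
  using cnj_mult_in_unit_disc[OF assms] by auto

text \<open>Differentiating the geometric series twice gives a convergent majorant with factors
  (n+1)(n+2), which dominate the squares.\<close>

lemma summable_square_mult_power:
  fixes r :: real
  assumes "\<bar>r\<bar> < 1"
  shows "summable (\<lambda>n. (real (Suc n))\<^sup>2 * r ^ n)"
proof -
  have g: "summable (\<lambda>n. 1 * x ^ n)" if "norm x < 1" for x :: real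
    using summable_geometric[OF that] by simp
  have d: "summable (\<lambda>n. diffs (\<lambda>_. 1) n * x ^ n)" if "norm x < 1" for x :: real
    using termdiff_converges[OF that g] .
  have dd: "summable (\<lambda>n. diffs (diffs (\<lambda>_. 1)) n * \<bar>r\<bar> ^ n)"
    using termdiff_converges[of "\<bar>r\<bar>" 1, OF _ d] assms by simp
  show ?thesis
    by (rule summable_comparison_test'[OF dd])
      (auto simp: diffs_def abs_mult power_abs power2_eq_square intro!: mult_right_mono mult_left_mono)
qed

lemma square_summable_deriv_kernel:
  assumes "p \<in> unit_disc"
  shows "summable (\<lambda>n. (cmod (of_nat n * cnj p ^ (n - 1)))\<^sup>2)"
proof -
  have "\<bar>(cmod p)\<^sup>2\<bar> < 1"
    using assms by (simp add: abs_square_less_1)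
  from summable_square_mult_power[OF this]
  have "summable (\<lambda>n. (cmod (of_nat (Suc n) * cnj p ^ (Suc n - 1)))\<^sup>2)"
    by (simp add: norm_mult norm_power power_mult_distrib power_mult[symmetric] mult.commute
        del: of_nat_Suc)
  then show ?thesis
    by (subst (asm) summable_Suc_iff)
qed

lemma square_summable_kernel:
  assumes "p \<in> unit_disc"
  shows "summable (\<lambda>n. (cmod (cnj p ^ n))\<^sup>2)"
  using assms by (intro square_summable_geometric) simp

lemma hardy2_kernel_in: "p \<in> unit_disc \<Longrightarrow> hardy2_kernel p \<in> hardy2"
  unfolding hardy2_kernel_def by (intro hardy2_of_coeffs_in square_summable_kernel)

lemma hardy2_deriv_kernel_in: "p \<in> unit_disc \<Longrightarrow> hardy2_deriv_kernel p \<in> hardy2"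
  unfolding hardy2_deriv_kernel_def by (intro hardy2_of_coeffs_in square_summable_deriv_kernel)

lemma hardy2_kernel_eq:
  assumes "p \<in> unit_disc" "z \<in> unit_disc"
  shows "hardy2_kernel p z = 1 / (1 - cnj p * z)"
proof -
  have "(\<Sum>n. (cnj p * z) ^ n) = 1 / (1 - cnj p * z)"
    using cnj_mult_in_unit_disc[OF assms] by (intro suminf_geometric) simp
  then show ?thesis
    using assms(2) by (simp add: hardy2_kernel_def hardy2_of_coeffs_def power_mult_distrib)
qed

lemma hardy2_deriv_kernel_eq:
  assumes "p \<in> unit_disc" "z \<in> unit_disc"
  shows "hardy2_deriv_kernel p z = z / (1 - cnj p * z)\<^sup>2"
proof -
  have "(\<lambda>n. of_nat (Suc n) * (cnj p * z) ^ n) sums (1 / (1 - cnj p * z)\<^sup>2)"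
    using cnj_mult_in_unit_disc[OF assms] by (intro geometric_deriv_sums) simp
  then have "(\<lambda>n. z * (of_nat (Suc n) * (cnj p * z) ^ n)) sums (z * (1 / (1 - cnj p * z)\<^sup>2))"
    by (rule sums_mult)
  moreover have "(\<lambda>n. z * (of_nat (Suc n) * (cnj p * z) ^ n))
      = (\<lambda>n. (\<lambda>n. of_nat n * cnj p ^ (n - 1) * z ^ n) (Suc n))"
    by (simp add: power_mult_distrib mult_ac)
  ultimately have "(\<lambda>n. (\<lambda>n. of_nat n * cnj p ^ (n - 1) * z ^ n) (Suc n))
      sums (z / (1 - cnj p * z)\<^sup>2)"
    by simp
  \<comment> \<open>The index shift leaves the sum unchanged because the term at n = 0 is
    zero.\<close>
  then have "(\<lambda>n. of_nat n * cnj p ^ (n - 1) * z ^ n) sums (z / (1 - cnj p * z)\<^sup>2)"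
    by (subst (asm) sums_Suc_iff) simp
  then show ?thesis
    using assms(2) by (simp add: hardy2_deriv_kernel_def hardy2_of_coeffs_def sums_iff)
qed

lemma hardy2_inner_kernel:
  assumes "f \<in> hardy2" "p \<in> unit_disc"
  shows "hardy2_inner f (hardy2_kernel p) = f p"
  using maclaurin_coeff_sums[OF hardy2D(1)[OF assms(1)] assms(2)]
    maclaurin_coeff_of_coeffs[OF square_summable_kernel[OF assms(2)]]
  by (simp add: hardy2_inner_def hardy2_kernel_def sums_iff)

lemma hardy2_inner_deriv_kernel:
  assumes "f \<in> hardy2" "p \<in> unit_disc"
  shows "hardy2_inner f (hardy2_deriv_kernel p) = deriv f p"
proof -
  let ?a = "maclaurin_coeff f"
  note s = maclaurin_coeff_sums[OF hardy2D(1)[OF assms(1)]]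
  have sm: "summable (\<lambda>n. ?a n * x ^ n)" if "norm x < 1" for x
    using s[of x] that by (auto simp: sums_iff)
  have p: "norm p < 1" using assms(2) by simp
  have "(\<lambda>n. of_nat n * ?a n * p ^ (n - Suc 0)) sums (\<Sum>n. diffs ?a n * p ^ n)"
    by (rule diffs_equiv[OF termdiff_converges[OF p sm]])
  moreover have "DERIV f p :> (\<Sum>n. diffs ?a n * p ^ n)"
  proof (rule has_field_derivative_transform_within_open)
    \<comment> \<open>Termwise differentiation at \<open>p\<close> needs a point of convergence of
      larger modulus, still inside the disc.\<close>
    obtain K where K: "norm p < K" "K < 1" using dense[OF p] by blast
    moreover have "0 < K" using le_less_trans[OF norm_ge_zero K(1)] .
    ultimately show "DERIV (\<lambda>x. \<Sum>n. ?a n * x ^ n) p :> (\<Sum>n. diffs ?a n * p ^ n)"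
      by (intro termdiffs_strong[where K="of_real K"] sm) auto
    show "(\<Sum>n. ?a n * x ^ n) = f x" if "x \<in> unit_disc" for x
      using s[OF that] by (simp add: sums_iff)
  qed (use assms in auto)
  ultimately show ?thesis
    using maclaurin_coeff_of_coeffs[OF square_summable_deriv_kernel[OF assms(2)]]
    by (simp add: hardy2_inner_def hardy2_deriv_kernel_def sums_iff DERIV_imp_deriv mult_ac)
qed

section \<open>Bounded and normal operators\<close>

lemma hardy2_boundedD:
  assumes "hardy2_bounded T"
  shows "f \<in> hardy2 \<Longrightarrow> T f \<in> hardy2"
    and "f \<in> hardy2 \<Longrightarrow> g \<in> hardy2 \<Longrightarrow> T (\<lambda>z. f z + g z) = (\<lambda>z. T f z + T g z)"
    and "f \<in> hardy2 \<Longrightarrow> T (\<lambda>z. c * f z) = (\<lambda>z. c * T f z)"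
  using assms by (auto simp: hardy2_bounded_def)

lemma hardy2_bounded_inner_bound:
  assumes "hardy2_bounded T" "g \<in> hardy2"
  obtains C where "0 \<le> C" "\<And>f. f \<in> hardy2 \<Longrightarrow> cmod (hardy2_inner (T f) g) \<le> C * hardy2_norm f"
proof -
  obtain C where C: "\<And>f. f \<in> hardy2 \<Longrightarrow> hardy2_norm (T f) \<le> C * hardy2_norm f"
    using assms unfolding hardy2_bounded_def by blast
  show ?thesis
  \<comment> \<open>The absolute value makes the constant nonnegative outright, without an argument
    about the sign of \<open>C\<close>.\<close>
  proof (rule that[of "\<bar>C\<bar> * hardy2_norm g"])
    show "0 \<le> \<bar>C\<bar> * hardy2_norm g" using hardy2_norm_nonneg[OF assms(2)] by simp
    fix f assume f: "f \<in> hardy2"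
    have "cmod (hardy2_inner (T f) g) \<le> hardy2_norm (T f) * hardy2_norm g"
      by (intro hardy2_Cauchy_Schwarz hardy2_boundedD(1)[OF assms(1)] f assms(2))
    also have "\<dots> \<le> (C * hardy2_norm f) * hardy2_norm g"
      by (intro mult_right_mono C f hardy2_norm_nonneg assms(2))
    also have "\<dots> \<le> (\<bar>C\<bar> * hardy2_norm f) * hardy2_norm g"
      by (intro mult_right_mono hardy2_norm_nonneg assms(2) f) simp
    finally show "cmod (hardy2_inner (T f) g) \<le> \<bar>C\<bar> * hardy2_norm g * hardy2_norm f"
      by (simp add: mult_ac)
  qed
qed

text \<open>Riesz representation done on coefficients: for fixed \<open>g\<close> the bounded
  functional sending \<open>f\<close> to \<open>hardy2_inner (T f) g\<close> is represented by the
  function whose coefficients are the conjugates of its values on the monomials. Choosing one such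
  function for each \<open>g\<close> gives the adjoint.\<close>

lemma hardy2_bounded_imp_adjoint:
  assumes T: "hardy2_bounded T"
  shows "\<exists>S. hardy2_is_adjoint T S"
proof -
  have "\<exists>h\<in>hardy2. \<forall>f\<in>hardy2. hardy2_inner (T f) g = hardy2_inner f h" if g: "g \<in> hardy2" for g
  proof -
    obtain C where C: "0 \<le> C"
      "\<And>f. f \<in> hardy2 \<Longrightarrow> cmod (hardy2_inner (T f) g) \<le> C * hardy2_norm f"
      using hardy2_bounded_inner_bound[OF T g] by blast
    \<comment> \<open>Here \<open>e n\<close> is the monomial of degree n, \<open>b n\<close> the
      only possible n-th coefficient of the representing function, and \<open>t a N\<close> the
      polynomial of the first \<open>N\<close> terms.\<close>
    define e where "e = (\<lambda>n. hardy2_of_coeffs (\<lambda>k. if k = n then 1 else 0))"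
    define b where "b = (\<lambda>n. cnj (hardy2_inner (T (e n)) g))"
    define t where "t = (\<lambda>a N. hardy2_of_coeffs (\<lambda>k. if k < N then a k else 0))"
    note Tin = hardy2_boundedD(1)[OF T]
    have se: "summable (\<lambda>k. (cmod (if k = n then 1 else 0))\<^sup>2)" for n :: nat
      by (rule summable_finite[of "{n}"]) auto
    have st: "summable (\<lambda>k. (cmod (if k < N then a k else 0))\<^sup>2)" for a :: "nat \<Rightarrow> complex" and N
      by (rule summable_finite[of "{..<N}"]) auto
    have ein: "e n \<in> hardy2" for n
      unfolding e_def by (rule hardy2_of_coeffs_in[OF se])
    have tin: "t a N \<in> hardy2" for a N
      unfolding t_def by (rule hardy2_of_coeffs_in[OF st])
    \<comment> \<open>The zero function appears as a multiple of an element of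
      \<open>hardy2\<close>, so that homogeneity of \<open>T\<close> yields the base case of the
      induction below.\<close>
    have t0: "t a 0 = (\<lambda>z. 0 * e 0 z)" for a
      by (auto simp: t_def hardy2_of_coeffs_def)
    have tSuc: "t a (Suc N) = (\<lambda>z. t a N z + a N * e N z)" for a N
    proof -
      have s: "summable (\<lambda>k. (cmod (a N * (if k = N then 1 else 0)))\<^sup>2)"
        by (rule summable_finite[of "{N}"]) auto
      have "(\<lambda>k. if k < Suc N then a k else 0)
          = (\<lambda>k. (if k < N then a k else 0) + a N * (if k = N then 1 else 0))"
        by (auto simp: fun_eq_iff less_Suc_eq)
      then show ?thesis
        unfolding t_def e_def using hardy2_of_coeffs_add[OF st s] hardy2_of_coeffs_mult[OF se]
        by simp
    qed
    have Tt: "hardy2_inner (T (t a N)) g = (\<Sum>n<N. a n * cnj (b n))" for a N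
    proof (induction N)
      case 0
      have "T (t a 0) = (\<lambda>z. 0 * T (e 0) z)"
        unfolding t0 by (rule hardy2_boundedD(3)[OF T ein])
      then show ?case
        using hardy2_inner_mult_left[OF Tin[OF ein] g, of 0 0] by simp
    next
      case (Suc N)
      show ?case
        by (simp add: tSuc hardy2_boundedD(2)[OF T tin hardy2_mult[OF ein]]
            hardy2_boundedD(3)[OF T ein] hardy2_inner_add_left hardy2_inner_mult_left
            hardy2_mult Tin tin ein g Suc.IH) (simp add: b_def)
    qed
    have norm_t: "(hardy2_norm (t a N))\<^sup>2 = (\<Sum>n<N. (cmod (a n))\<^sup>2)" for a N
    proof -
      have "(\<Sum>k. (cmod (if k < N then a k else 0))\<^sup>2) = (\<Sum>k<N. (cmod (a k))\<^sup>2)"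
        by (subst suminf_finite[of "{..<N}"]) auto
      then show ?thesis
        using hardy2_norm_eq[OF tin, of a N] maclaurin_coeff_of_coeffs[OF st, of N a]
        by (simp add: t_def sum_nonneg)
    qed
    \<comment> \<open>Evaluating the functional at the truncation of \<open>b\<close> itself, whose
      norm is \<open>x\<close>, gives \<open>x\<^sup>2\<close> on the left and at most
      \<open>C * x\<close> on the right.\<close>
    have "(\<Sum>n<N. (cmod (b n))\<^sup>2) \<le> C\<^sup>2" for N
    proof -
      define x where "x = hardy2_norm (t b N)"
      have x0: "0 \<le> x" unfolding x_def by (rule hardy2_norm_nonneg[OF tin])
      have "(\<Sum>n<N. b n * cnj (b n)) = of_real (x\<^sup>2)"
        unfolding x_def norm_t by (simp only: of_real_sum complex_norm_square)
      then have "x\<^sup>2 = cmod (\<Sum>n<N. b n * cnj (b n))"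
        by (simp only: norm_of_real) simp
      also have "\<dots> \<le> C * x"
        using C(2)[OF tin, of b N] by (simp add: Tt x_def)
      finally have "x * x \<le> C * x" by (simp add: power2_eq_square)
      then have "x \<le> C" using x0 C(1) by (cases "x = 0") auto
      then have "x\<^sup>2 \<le> C\<^sup>2" using x0 by (intro power_mono)
      then show ?thesis by (simp add: x_def norm_t)
    qed
    then have sb: "summable (\<lambda>n. (cmod (b n))\<^sup>2)"
      by (intro summableI_nonneg_bounded) auto
    show ?thesis
    proof (intro bexI ballI)
      show "hardy2_of_coeffs b \<in> hardy2" by (rule hardy2_of_coeffs_in[OF sb])
      fix f assume f: "f \<in> hardy2"
      define a where "a = maclaurin_coeff f"
      have sa: "summable (\<lambda>n. (cmod (a n))\<^sup>2)" using hardy2D(3)[OF f] by (simp add: a_def)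
      \<comment> \<open>The tail complementary to \<open>t a N\<close>. Its norm tends to 0, so the
        functional, being bounded, is determined by its values on the truncations.\<close>
      define r where "r = (\<lambda>N. hardy2_of_coeffs (\<lambda>k. if k < N then 0 else a k))"
      have sr: "summable (\<lambda>k. (cmod (if k < N then 0 else a k))\<^sup>2)" for N
        by (rule summable_comparison_test'[OF sa]) auto
      have rin: "r N \<in> hardy2" for N
        unfolding r_def by (rule hardy2_of_coeffs_in[OF sr])
      have fr: "f = (\<lambda>z. t a N z + r N z)" for N
      proof -
        have "f = hardy2_of_coeffs a" by (simp add: a_def hardy2_of_coeffs_maclaurin_coeff f)
        also have "a = (\<lambda>k. (if k < N then a k else 0) + (if k < N then 0 else a k))" by auto
        also have "hardy2_of_coeffs \<dots> = (\<lambda>z. t a N z + r N z)"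
          unfolding t_def r_def by (rule hardy2_of_coeffs_add[OF st sr])
        finally show ?thesis .
      qed
      have norm_r: "(hardy2_norm (r N))\<^sup>2 = (\<Sum>k. (cmod (a (k + N)))\<^sup>2)" for N
      proof -
        have "(\<Sum>k. (cmod (if k < N then 0 else a k))\<^sup>2) = (\<Sum>k. (cmod (a (k + N)))\<^sup>2)"
          using suminf_split_initial_segment[OF sr, of N N] by simp
        moreover have "0 \<le> (\<Sum>k. (cmod (if k < N then 0 else a k))\<^sup>2)"
          by (rule suminf_nonneg[OF sr]) simp
        ultimately show ?thesis
          using hardy2_norm_eq[OF rin, of N] maclaurin_coeff_of_coeffs[OF sr, of N]
          by (simp add: r_def)
      qed
      have "(\<lambda>N. (hardy2_norm (r N))\<^sup>2) \<longlonglongrightarrow> 0"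
        unfolding norm_r by (rule suminf_exist_split2[OF sa])
      then have "(\<lambda>N. sqrt ((hardy2_norm (r N))\<^sup>2)) \<longlonglongrightarrow> sqrt 0"
        by (rule tendsto_real_sqrt)
      then have "(\<lambda>N. hardy2_norm (r N)) \<longlonglongrightarrow> 0"
        by (simp add: hardy2_norm_nonneg rin)
      then have "(\<lambda>N. C * hardy2_norm (r N)) \<longlonglongrightarrow> 0"
        by (rule tendsto_mult_right_zero)
      then have "(\<lambda>N. hardy2_inner (T (r N)) g) \<longlonglongrightarrow> 0"
        by (rule Lim_null_comparison[rotated]) (simp add: C rin)
      moreover have "hardy2_inner (T (r N)) g = hardy2_inner (T f) g - (\<Sum>n<N. a n * cnj (b n))" for N
      proof -
        have "T f = (\<lambda>z. T (t a N) z + T (r N) z)"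
          by (subst fr[of N]) (rule hardy2_boundedD(2)[OF T tin rin])
        then show ?thesis by (simp add: hardy2_inner_add_left Tin tin rin g Tt)
      qed
      ultimately have "(\<lambda>N. hardy2_inner (T f) g - (\<Sum>n<N. a n * cnj (b n))) \<longlonglongrightarrow> 0"
        by simp
      then have "(\<lambda>n. a n * cnj (b n)) sums hardy2_inner (T f) g"
        unfolding sums_def using tendsto_diff[OF tendsto_const[of "hardy2_inner (T f) g"]] by fastforce
      then show "hardy2_inner (T f) g = hardy2_inner f (hardy2_of_coeffs b)"
        by (simp add: hardy2_inner_def maclaurin_coeff_of_coeffs[OF sb] a_def sums_iff)
    qed
  qed
  \<comment> \<open>Moving membership into an implication makes the statement total in
    \<open>g\<close>, so choice yields a function \<open>S\<close> on the whole type.\<close>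
  then have "\<forall>g. \<exists>h. g \<in> hardy2 \<longrightarrow> h \<in> hardy2 \<and> (\<forall>f\<in>hardy2. hardy2_inner (T f) g = hardy2_inner f h)"
    by blast
  then obtain S where "\<forall>g. g \<in> hardy2 \<longrightarrow> S g \<in> hardy2 \<and>
      (\<forall>f\<in>hardy2. hardy2_inner (T f) g = hardy2_inner f (S g))"
    by metis
  then show ?thesis
    unfolding hardy2_is_adjoint_def by blast
qed

text \<open>The hypothesis \<open>eig\<close> says weakly that \<open>f\<close> is an eigenvector of
  the adjoint for \<open>cnj c\<close>. For normal \<open>T\<close> the vectors (T - c) f and (T -
  c)* f have equal norm, so the first vanishes with the second. The proof expands the square of the
  first norm directly.\<close>

lemma hardy2_normal_eigenvector:
  assumes "hardy2_normal T" and f: "f \<in> hardy2"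
    and eig: "\<And>g. g \<in> hardy2 \<Longrightarrow> hardy2_inner (T g) f = c * hardy2_inner g f"
  shows "T f = (\<lambda>z. c * f z)"
proof -
  from assms(1) obtain S where T: "hardy2_bounded T" and S: "hardy2_is_adjoint T S"
    and comm: "\<And>g. g \<in> hardy2 \<Longrightarrow> T (S g) = S (T g)"
    by (auto simp: hardy2_normal_def)
  have Tf: "T f \<in> hardy2" using hardy2_boundedD(1)[OF T f] .
  have Sin: "g \<in> hardy2 \<Longrightarrow> S g \<in> hardy2"
    and adj: "g \<in> hardy2 \<Longrightarrow> h \<in> hardy2 \<Longrightarrow> hardy2_inner (T g) h = hardy2_inner g (S h)" for g h
    using S by (auto simp: hardy2_is_adjoint_def)
  have Sf: "S f = (\<lambda>z. cnj c * f z)"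
    by (rule hardy2_eqI) (simp_all add: Sin f hardy2_mult hardy2_inner_mult_right eig flip: adj)
  have fTf: "hardy2_inner f (T f) = cnj c * hardy2_inner f f"
    using hardy2_inner_commute[OF Tf f] hardy2_inner_commute[OF f f] by (simp add: eig f)
  \<comment> \<open>Commutation with the adjoint enters here: \<open>S (T f)\<close> is replaced by
    \<open>T (S f)\<close>, and \<open>S f\<close> is known.\<close>
  have TT: "hardy2_inner (T f) (T f) = c * cnj c * hardy2_inner f f"
  proof -
    have "hardy2_inner (T f) (T f) = hardy2_inner f (T (S f))"
      by (simp add: adj f Tf comm)
    also have "\<dots> = c * hardy2_inner f (T f)"
      by (simp add: Sf hardy2_boundedD(3)[OF T f] hardy2_inner_mult_right f Tf)
    finally show ?thesis by (simp add: fTf)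
  qed
  let ?d = "\<lambda>z. T f z + (- c) * f z"
  have cf: "(\<lambda>z. (- c) * f z) \<in> hardy2" by (rule hardy2_mult[OF f])
  have d: "?d \<in> hardy2" by (rule hardy2_add[OF Tf cf])
  \<comment> \<open>Each of the four terms of the expansion is
    \<open>c * cnj c * hardy2_inner f f\<close> up to sign, with two signs of each kind.\<close>
  have "hardy2_inner ?d ?d = 0"
    unfolding hardy2_inner_add_left[OF Tf cf d] hardy2_inner_add_right[OF Tf cf Tf]
      hardy2_inner_mult_left[OF f d] hardy2_inner_mult_right[OF f Tf]
      hardy2_inner_add_right[OF Tf cf f] hardy2_inner_mult_right[OF f f] TT
    by (simp add: eig f fTf algebra_simps)
  from hardy2_inner_self_eq_0[OF d this] show ?thesis
    by (auto simp: fun_eq_iff)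
qed

section \<open>The disc involution\<close>

text \<open>The sign does not change the modulus, so the library bound for Moebius functions shows
  that the involution preserves the disc.\<close>

lemma disc_involution_eq_Moebius: "disc_involution p z = - Moebius_function 0 p z"
  by (simp add: disc_involution_def Moebius_function_def minus_divide_left)

lemma disc_involution_in:
  assumes "p \<in> unit_disc" "z \<in> unit_disc"
  shows "disc_involution p z \<in> unit_disc"
  using Moebius_function_norm_lt_1[of p z 0] assms by (simp add: disc_involution_eq_Moebius)

lemma one_minus_cnj_self_neq_0: "p \<in> unit_disc \<Longrightarrow> 1 - cnj p * p \<noteq> 0"
  by (rule one_minus_cnj_mult_neq_0)

lemma one_minus_cnj_disc_involution:
  assumes "p \<in> unit_disc" "z \<in> unit_disc"
  shows "1 - cnj p * disc_involution p z = (1 - cnj p * p) / (1 - cnj p * z)"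
  using one_minus_cnj_mult_neq_0[OF assms]
  by (simp add: disc_involution_def field_simps)

lemma disc_involution_involution:
  assumes "p \<in> unit_disc" "z \<in> unit_disc"
  shows "disc_involution p (disc_involution p z) = z"
proof -
  note nz = one_minus_cnj_mult_neq_0[OF assms] one_minus_cnj_self_neq_0[OF assms(1)]
  have "p - disc_involution p z = z * (1 - cnj p * p) / (1 - cnj p * z)"
    using nz by (simp add: disc_involution_def field_simps)
  then show ?thesis
    using nz by (subst disc_involution_def) (simp add: one_minus_cnj_disc_involution[OF assms])
qed

text \<open>Transformation law of the Szego kernel under the involution; for u = v it is the
  identity behind the Schwarz-Pick lemma.\<close>

lemma one_minus_cnj_disc_involution_mult:
  assumes "p \<in> unit_disc" "u \<in> unit_disc" "v \<in> unit_disc"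
  shows "1 - cnj (disc_involution p u) * disc_involution p v
    = (1 - cnj p * p) * (1 - cnj u * v) / ((1 - p * cnj u) * (1 - cnj p * v))"
proof -
  have "cnj (1 - cnj p * u) \<noteq> 0"
    using one_minus_cnj_mult_neq_0[OF assms(1,2)] by (subst complex_cnj_zero_iff)
  then have "1 - p * cnj u \<noteq> 0" by simp
  then show ?thesis
    using one_minus_cnj_mult_neq_0[OF assms(1,3)]
    by (simp add: disc_involution_def divide_simps) (simp add: algebra_simps)
qed

section \<open>Conjugates of multiplication by a constant, with their weights\<close>

lemma mult_in_unit_disc:
  assumes "cmod \<delta> \<le> 1" "z \<in> unit_disc"
  shows "\<delta> * z \<in> unit_disc"
proof -
  have "cmod \<delta> * cmod z \<le> 1 * cmod z" using assms by (intro mult_right_mono) auto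
  then show ?thesis using assms by (simp add: norm_mult)
qed

definition disc_symbol :: "complex \<Rightarrow> complex \<Rightarrow> complex \<Rightarrow> complex" where
  "disc_symbol p \<delta> z = disc_involution p (\<delta> * disc_involution p z)"

definition disc_weight :: "complex \<Rightarrow> complex \<Rightarrow> complex \<Rightarrow> complex \<Rightarrow> complex" where
  "disc_weight p \<gamma> \<delta> z = \<gamma> * (szego_kernel p z / szego_kernel p (disc_symbol p \<delta> z))"

lemma disc_symbol_in:
  assumes "p \<in> unit_disc" "cmod \<delta> \<le> 1" "z \<in> unit_disc"
  shows "disc_symbol p \<delta> z \<in> unit_disc"
  unfolding disc_symbol_def
  by (intro disc_involution_in mult_in_unit_disc assms)

text \<open>The two inner involutions cancel, so composition becomes multiplication of the
  parameters.\<close>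

lemma disc_symbol_disc_symbol:
  assumes "p \<in> unit_disc" "cmod \<delta> \<le> 1" "z \<in> unit_disc"
  shows "disc_symbol p \<epsilon> (disc_symbol p \<delta> z) = disc_symbol p (\<epsilon> * \<delta>) z"
  using assms
  by (simp add: disc_symbol_def disc_involution_involution mult_in_unit_disc[simplified]
      disc_involution_in[simplified] mult.assoc)

text \<open>The quotients of kernel values telescope along z, its image and the image of that. With
  the law for symbols, this makes operators with the same \<open>p\<close> commute.\<close>

lemma disc_weight_disc_weight:
  assumes "p \<in> unit_disc" "cmod \<delta> \<le> 1" "z \<in> unit_disc"
  shows "disc_weight p \<gamma> \<delta> z * disc_weight p \<eta> \<epsilon> (disc_symbol p \<delta> z)
    = disc_weight p (\<gamma> * \<eta>) (\<epsilon> * \<delta>) z"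
  using one_minus_cnj_mult_neq_0[OF assms(1) disc_symbol_in[OF assms]]
  by (simp add: disc_weight_def szego_kernel_def disc_symbol_disc_symbol[OF assms])

text \<open>The left side is the value at \<open>z\<close> of the operator applied to the kernel at
  \<open>q\<close>. In the closed form \<delta> occurs only between the conjugated involution of
  \<open>q\<close> and the involution of \<open>z\<close>.\<close>

lemma disc_weight_kernel:
  assumes "p \<in> unit_disc" "cmod \<delta> \<le> 1" "z \<in> unit_disc" "q \<in> unit_disc"
  shows "disc_weight p \<gamma> \<delta> z / (1 - cnj q * disc_symbol p \<delta> z)
    = \<gamma> * (1 - cnj p * p) / ((1 - cnj p * z) * (1 - p * cnj q) *
        (1 - cnj (disc_involution p q) * \<delta> * disc_involution p z))"
proof -
  \<comment> \<open>Writing \<open>q\<close> as the involution of \<open>u\<close> turns both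
    \<open>q\<close> and the symbol value into images under the involution, so the transformation
    law of the kernel applies.\<close>
  define u where "u = disc_involution p q"
  define v where "v = \<delta> * disc_involution p z"
  have u: "u \<in> unit_disc" unfolding u_def by (intro disc_involution_in assms)
  have v: "v \<in> unit_disc" unfolding v_def by (intro mult_in_unit_disc disc_involution_in assms)
  have q: "q = disc_involution p u" by (simp add: u_def disc_involution_involution[OF assms(1,4)])
  have "cnj (1 - cnj p * q) \<noteq> 0" "cnj (1 - cnj p * u) \<noteq> 0"
    unfolding complex_cnj_zero_iff by (intro one_minus_cnj_mult_neq_0 assms u)+
  then have nz: "1 - p * cnj q \<noteq> 0" "1 - p * cnj u \<noteq> 0" by simp_all
  have "cnj (1 - cnj p * u) = cnj ((1 - cnj p * p) / (1 - cnj p * q))"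
    unfolding u_def by (subst one_minus_cnj_disc_involution[OF assms(1,4)]) (rule refl)
  then have pu: "1 - p * cnj u = (1 - cnj p * p) / (1 - p * cnj q)" by (simp add: mult.commute)
  have *: "1 - cnj q * disc_involution p v
      = (1 - cnj p * p) * (1 - cnj u * v) / ((1 - p * cnj u) * (1 - cnj p * v))"
    unfolding q by (rule one_minus_cnj_disc_involution_mult[OF assms(1) u v])
  have "disc_weight p \<gamma> \<delta> z / (1 - cnj q * disc_symbol p \<delta> z)
      = \<gamma> * ((1 - cnj p * p) / (1 - cnj p * v)) / (1 - cnj p * z)
        / ((1 - cnj p * p) * (1 - cnj u * v) / ((1 - p * cnj u) * (1 - cnj p * v)))"
    unfolding *[symmetric] one_minus_cnj_disc_involution[OF assms(1) v, symmetric]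
    by (simp add: disc_weight_def disc_symbol_def szego_kernel_def v_def)
  also have "\<dots> = \<gamma> * (1 - p * cnj u) / ((1 - cnj p * z) * (1 - cnj u * v))"
    using one_minus_cnj_mult_neq_0[OF assms(1) v] one_minus_cnj_self_neq_0[OF assms(1)] nz
    by simp
  also have "\<dots> = \<gamma> * (1 - cnj p * p) / ((1 - cnj p * z) * (1 - p * cnj q) * (1 - cnj u * v))"
    unfolding pu by (simp add: mult_ac)
  finally show ?thesis by (simp add: u_def v_def mult.assoc)
qed

text \<open>The closed form just obtained is unchanged by conjugating while exchanging z and q.\<close>

lemma disc_weight_kernel_swap:
  assumes "p \<in> unit_disc" "cmod \<delta> \<le> 1" "z \<in> unit_disc" "q \<in> unit_disc"
  shows "disc_weight p \<gamma> \<delta> z / (1 - cnj q * disc_symbol p \<delta> z)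
    = cnj (disc_weight p (cnj \<gamma>) (cnj \<delta>) q)
        / (1 - cnj (disc_symbol p (cnj \<delta>) q) * z)"
proof -
  have "cmod (cnj \<delta>) \<le> 1" using assms(2) by simp
  note e = disc_weight_kernel[OF assms(1) this assms(4,3), of "cnj \<gamma>"]
  have "cnj (disc_weight p (cnj \<gamma>) (cnj \<delta>) q) / (1 - cnj (disc_symbol p (cnj \<delta>) q) * z)
      = cnj (disc_weight p (cnj \<gamma>) (cnj \<delta>) q / (1 - cnj z * disc_symbol p (cnj \<delta>) q))"
    by (simp add: mult.commute)
  also have "\<dots> = disc_weight p \<gamma> \<delta> z / (1 - cnj q * disc_symbol p \<delta> z)"
    unfolding e disc_weight_kernel[OF assms] by (simp add: mult_ac)
  finally show ?thesis by simp
qed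

section \<open>Normal weighted composition operators\<close>

text \<open>Boundedness supplies an adjoint \<open>S\<close>. Pairing \<open>S g\<close> with
  kernels computes its values and exhibits \<open>S\<close> on \<open>hardy2\<close> as the operator
  with conjugated parameters.\<close>

lemma weighted_comp_disc_symbol_normal:
  assumes p: "p \<in> unit_disc" and \<delta>: "cmod \<delta> \<le> 1"
    and \<psi>: "\<And>z. z \<in> unit_disc \<Longrightarrow> \<psi> z = disc_weight p \<gamma> \<delta> z"
    and \<phi>: "\<And>z. z \<in> unit_disc \<Longrightarrow> \<phi> z = disc_symbol p \<delta> z"
    and T: "hardy2_bounded (weighted_comp \<psi> \<phi>)"
  shows "hardy2_normal (weighted_comp \<psi> \<phi>)"
proof -
  let ?T = "weighted_comp \<psi> \<phi>"
  let ?w = "disc_weight p (cnj \<gamma>) (cnj \<delta>)" and ?s = "disc_symbol p (cnj \<delta>)"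
  have \<delta>': "cmod (cnj \<delta>) \<le> 1" using \<delta> by simp
  obtain S where S: "hardy2_is_adjoint ?T S"
    using hardy2_bounded_imp_adjoint[OF T] by blast
  have Sin: "g \<in> hardy2 \<Longrightarrow> S g \<in> hardy2"
    and adj: "g \<in> hardy2 \<Longrightarrow> h \<in> hardy2 \<Longrightarrow> hardy2_inner (?T g) h = hardy2_inner g (S h)" for g h
    using S by (auto simp: hardy2_is_adjoint_def)
  have S_eq: "S g = weighted_comp ?w ?s g" if g: "g \<in> hardy2" for g
  proof
    fix q
    show "S g q = weighted_comp ?w ?s g q"
    proof (cases "q \<in> unit_disc")
      case False
      then show ?thesis using hardy2D(2)[OF Sin[OF g]] by (simp add: weighted_comp_def)
    next
      case q: True
      note k = hardy2_kernel_in[OF q]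
      have r: "?s q \<in> unit_disc" by (rule disc_symbol_in[OF p \<delta>' q])
      note kr = hardy2_kernel_in[OF r]
      \<comment> \<open>By the exchange of \<open>z\<close> and \<open>q\<close>, the image of a
        kernel is a multiple of the kernel at \<open>?s q\<close>; the scalar is the conjugate of
        the adjoint's weight.\<close>
      have "?T (hardy2_kernel q) = (\<lambda>z. cnj (?w q) * hardy2_kernel (?s q) z)"
      proof
        fix z
        show "?T (hardy2_kernel q) z = cnj (?w q) * hardy2_kernel (?s q) z"
        proof (cases "z \<in> unit_disc")
          case False
          then show ?thesis using hardy2D(2)[OF kr] by (simp add: weighted_comp_def)
        next
          case z: True
          then show ?thesis
            using disc_weight_kernel_swap[OF p \<delta> z q, of \<gamma>]
              hardy2_kernel_eq[OF q disc_symbol_in[OF p \<delta> z]] hardy2_kernel_eq[OF r z] \<psi>[OF z] \<phi>[OF z]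
            by (simp add: weighted_comp_def)
        qed
      qed
      then have "hardy2_inner (hardy2_kernel q) (S g) = cnj (?w q) * hardy2_inner (hardy2_kernel (?s q)) g"
        using adj[OF k g] hardy2_inner_mult_left[OF kr g] by simp
      also have "hardy2_inner (hardy2_kernel (?s q)) g = cnj (g (?s q))"
        using hardy2_inner_commute[OF g kr] hardy2_inner_kernel[OF g r] by simp
      finally have "cnj (hardy2_inner (hardy2_kernel q) (S g)) = ?w q * g (?s q)" by simp
      then show ?thesis
        using hardy2_inner_commute[OF k Sin[OF g]] hardy2_inner_kernel[OF Sin[OF g] q] q
        by (simp add: weighted_comp_def)
    qed
  qed
  have "?T (S f) = S (?T f)" if f: "f \<in> hardy2" for f
  proof
    fix z
    show "?T (S f) z = S (?T f) z"
    proof (cases "z \<in> unit_disc")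
      case z: True
      note s = disc_symbol_in[OF p \<delta> z] disc_symbol_in[OF p \<delta>' z]
      have "?T (S f) z = disc_weight p \<gamma> \<delta> z * ?w (disc_symbol p \<delta> z) * f (?s (disc_symbol p \<delta> z))"
        using z s(1) by (simp add: S_eq[OF f] weighted_comp_def \<psi> \<phi>)
      \<comment> \<open>Both sides collapse to the weight and symbol with parameters
        \<open>\<gamma> * cnj \<gamma>\<close> and \<open>\<delta> * cnj \<delta>\<close>.\<close>
      also have "\<dots> = ?w z * disc_weight p \<gamma> \<delta> (?s z) * f (disc_symbol p \<delta> (?s z))"
        by (simp add: disc_weight_disc_weight[OF p \<delta> z] disc_weight_disc_weight[OF p \<delta>' z]
            disc_symbol_disc_symbol[OF p \<delta> z] disc_symbol_disc_symbol[OF p \<delta>' z] mult.commute)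
      also have "\<dots> = S (?T f) z"
        unfolding S_eq[OF hardy2_boundedD(1)[OF T f]]
        using z s(2) by (simp add: weighted_comp_def \<psi> \<phi>)
      finally show ?thesis .
    next
      case False
      then show ?thesis
        by (simp add: S_eq[OF hardy2_boundedD(1)[OF T f]]) (simp add: weighted_comp_def)
    qed
  qed
  with S T show ?thesis by (auto simp: hardy2_normal_def)
qed

text \<open>As \<open>p\<close> is fixed, evaluating the image of \<open>g\<close> at
  \<open>p\<close> gives \<psi>(p) g(p), so the kernel at \<open>p\<close> is an eigenvector of the
  adjoint, hence of the operator. Evaluating that equation at \<open>z\<close> and clearing
  denominators gives the claim.\<close>

lemma weighted_comp_normal_imp_weight:
  assumes sub: "\<phi> ` unit_disc \<subseteq> unit_disc"
    and N: "hardy2_normal (weighted_comp \<psi> \<phi>)"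
    and p: "p \<in> unit_disc" and fp: "\<phi> p = p" and z: "z \<in> unit_disc"
  shows "\<psi> z * (1 - cnj p * z) = \<psi> p * (1 - cnj p * \<phi> z)"
proof -
  let ?T = "weighted_comp \<psi> \<phi>"
  have T: "hardy2_bounded ?T" using N by (simp add: hardy2_normal_def)
  have "?T (hardy2_kernel p) = (\<lambda>z. \<psi> p * hardy2_kernel p z)"
  proof (rule hardy2_normal_eigenvector[OF N hardy2_kernel_in[OF p]])
    fix g assume g: "g \<in> hardy2"
    show "hardy2_inner (?T g) (hardy2_kernel p) = \<psi> p * hardy2_inner g (hardy2_kernel p)"
      using p fp by (simp only: hardy2_inner_kernel[OF g p]
        hardy2_inner_kernel[OF hardy2_boundedD(1)[OF T g] p]) (simp add: weighted_comp_def)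
  qed
  then have "?T (hardy2_kernel p) z = \<psi> p * hardy2_kernel p z" by simp
  moreover have \<phi>z: "\<phi> z \<in> unit_disc" using sub z by blast
  ultimately show ?thesis
    using z one_minus_cnj_mult_neq_0[OF p z] one_minus_cnj_mult_neq_0[OF p \<phi>z]
    by (simp add: weighted_comp_def hardy2_kernel_eq[OF p z] hardy2_kernel_eq[OF p \<phi>z] field_simps)
qed

text \<open>The eigenvector is the kernel at p times the involution, (p - z) / (1 - cnj p z)^2, which is
  a combination of the kernels for evaluation and for differentiation at p.\<close>

lemma weighted_comp_normal_imp_symbol:
  assumes hol: "\<phi> holomorphic_on unit_disc" and sub: "\<phi> ` unit_disc \<subseteq> unit_disc"
    and hol': "\<psi> holomorphic_on unit_disc"
    and nz: "\<exists>z\<in>unit_disc. \<psi> z \<noteq> 0"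
    and N: "hardy2_normal (weighted_comp \<psi> \<phi>)"
    and p: "p \<in> unit_disc" and fp: "\<phi> p = p" and z: "z \<in> unit_disc"
  shows "disc_involution p (\<phi> z) = deriv \<phi> p * disc_involution p z"
proof -
  let ?T = "weighted_comp \<psi> \<phi>"
  let ?K = "hardy2_kernel p" and ?D = "hardy2_deriv_kernel p"
  \<comment> \<open>This real constant makes the combination \<open>f\<close> equal to the kernel
    times the involution, as \<open>f_eq\<close> verifies.\<close>
  define m where "m = 1 - cnj p * p"
  have m: "m \<noteq> 0" "cnj m = m"
    using one_minus_cnj_self_neq_0[OF p] by (simp_all add: m_def)
  define f where "f = (\<lambda>z. p * ?K z + (- m) * ?D z)"
  have T: "hardy2_bounded ?T" using N by (simp add: hardy2_normal_def)
  note K = hardy2_kernel_in[OF p] and D = hardy2_deriv_kernel_in[OF p]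
  have f: "f \<in> hardy2" unfolding f_def by (intro hardy2_add hardy2_mult K D)
  have inner_f: "hardy2_inner g f = cnj p * g p - m * deriv g p" if g: "g \<in> hardy2" for g
    unfolding f_def hardy2_inner_add_right[OF hardy2_mult[OF K] hardy2_mult[OF D] g]
      hardy2_inner_mult_right[OF K g] hardy2_inner_mult_right[OF D g]
      hardy2_inner_kernel[OF g p] hardy2_inner_deriv_kernel[OF g p]
    by (simp add: m)
  have W: "\<psi> z * (1 - cnj p * z) = \<psi> p * (1 - cnj p * \<phi> z)" if "z \<in> unit_disc" for z
    by (rule weighted_comp_normal_imp_weight[OF sub N p fp that])
  have d\<phi>: "(\<phi> has_field_derivative deriv \<phi> p) (at p)"
    by (rule holomorphic_derivI[OF hol _ p]) simp
  have d\<psi>: "(\<psi> has_field_derivative deriv \<psi> p) (at p)"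
    by (rule holomorphic_derivI[OF hol' _ p]) simp
  \<comment> \<open>The weight identity is differentiated at \<open>p\<close> on both sides. The
    result expresses \<psi>'(p) through \<psi>(p) and \<phi>'(p).\<close>
  have "((\<lambda>z. \<psi> z * (1 - cnj p * z)) has_field_derivative
      deriv \<psi> p * m - \<psi> p * cnj p) (at p)"
    by (rule derivative_eq_intros d\<psi> refl | simp add: m_def algebra_simps)+
  moreover have "((\<lambda>z. \<psi> z * (1 - cnj p * z)) has_field_derivative
      - (\<psi> p * cnj p * deriv \<phi> p)) (at p)"
  proof (rule has_field_derivative_transform_within_open[where S=unit_disc])
    show "((\<lambda>z. \<psi> p * (1 - cnj p * \<phi> z)) has_field_derivative
        - (\<psi> p * cnj p * deriv \<phi> p)) (at p)"
      by (rule derivative_eq_intros d\<phi> refl | simp)+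
  qed (use p W in auto)
  ultimately have d\<psi>_eq: "deriv \<psi> p * m - \<psi> p * cnj p = - (\<psi> p * cnj p * deriv \<phi> p)"
    by (rule DERIV_unique)
  have "?T f = (\<lambda>z. (\<psi> p * deriv \<phi> p) * f z)"
  proof (rule hardy2_normal_eigenvector[OF N f])
    fix g assume g: "g \<in> hardy2"
    have Tg: "?T g \<in> hardy2" by (rule hardy2_boundedD(1)[OF T g])
    have dg: "(g has_field_derivative deriv g p) (at (\<phi> p))"
      unfolding fp by (rule holomorphic_derivI[OF hardy2D(1)[OF g] _ p]) simp
    have "(?T g has_field_derivative \<psi> p * (deriv g p * deriv \<phi> p) + deriv \<psi> p * g (\<phi> p)) (at p)"
    proof (rule has_field_derivative_transform_within_open[where S=unit_disc])
      show "((\<lambda>z. \<psi> z * g (\<phi> z)) has_field_derivative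
          \<psi> p * (deriv g p * deriv \<phi> p) + deriv \<psi> p * g (\<phi> p)) (at p)"
        using DERIV_mult[OF d\<psi> DERIV_chain2[OF dg d\<phi>]] by (simp add: add.commute mult_ac)
    qed (use p in \<open>auto simp: weighted_comp_def\<close>)
    then have dT: "deriv (?T g) p = \<psi> p * (deriv g p * deriv \<phi> p) + deriv \<psi> p * g p"
      unfolding fp by (rule DERIV_imp_deriv)
    have "?T g p = \<psi> p * g p" using p by (simp add: weighted_comp_def fp)
    then have "hardy2_inner (?T g) f
        = (\<psi> p * cnj p - deriv \<psi> p * m) * g p - \<psi> p * deriv \<phi> p * m * deriv g p"
      unfolding inner_f[OF Tg] dT by (simp add: algebra_simps)
    \<comment> \<open>Eliminating \<psi>'(p) gives the terms in g(p) and g'(p) the common factor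
      \<psi>(p) \<phi>'(p), which is the eigenvalue.\<close>
    also have "\<psi> p * cnj p - deriv \<psi> p * m = \<psi> p * cnj p * deriv \<phi> p"
      using arg_cong[OF d\<psi>_eq, of uminus] by simp
    finally show "hardy2_inner (?T g) f = \<psi> p * deriv \<phi> p * hardy2_inner g f"
      unfolding inner_f[OF g] by (simp add: algebra_simps)
  qed
  then have Tf: "?T f z = \<psi> p * deriv \<phi> p * f z" by simp
  have f_eq: "f w = disc_involution p w / (1 - cnj p * w)" if w: "w \<in> unit_disc" for w
  proof -
    have "f w = (p * (1 - cnj p * w) - m * w) / (1 - cnj p * w)\<^sup>2"
      using one_minus_cnj_mult_neq_0[OF p w]
      by (simp add: f_def hardy2_kernel_eq[OF p w] hardy2_deriv_kernel_eq[OF p w]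
          diff_divide_distrib power2_eq_square)
    also have "p * (1 - cnj p * w) - m * w = p - w" by (simp add: m_def algebra_simps)
    finally show ?thesis by (simp add: disc_involution_def power2_eq_square)
  qed
  have \<phi>z: "\<phi> z \<in> unit_disc" using sub z by blast
  note nzz = one_minus_cnj_mult_neq_0[OF p z] one_minus_cnj_mult_neq_0[OF p \<phi>z]
  \<comment> \<open>If \<psi>(p) were 0, the weight identity would make \<psi> vanish on the whole
    disc.\<close>
  have \<psi>p: "\<psi> p \<noteq> 0"
  proof
    assume "\<psi> p = 0"
    moreover obtain w where w: "w \<in> unit_disc" "\<psi> w \<noteq> 0" using nz by blast
    ultimately show False using W[OF w(1)] one_minus_cnj_mult_neq_0[OF p w(1)] by simp
  qed
  \<comment> \<open>After this substitution the factor \<open>1 - cnj p * \<phi> z\<close> cancels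
    against the denominator of \<open>f (\<phi> z)\<close>.\<close>
  have "\<psi> z = \<psi> p * (1 - cnj p * \<phi> z) / (1 - cnj p * z)"
    using W[OF z] nzz(1) by (simp add: field_simps)
  then have "\<psi> p * disc_involution p (\<phi> z) / (1 - cnj p * z)
      = \<psi> p * deriv \<phi> p * (disc_involution p z / (1 - cnj p * z))"
    using Tf z nzz(2) by (simp add: weighted_comp_def f_eq[OF z] f_eq[OF \<phi>z])
  then show ?thesis using \<psi>p nzz(1) by (simp add: divide_simps)
qed

text \<open>The hypothesis that \<psi> is not identically zero excludes the zero operator, which is
  normal for every \<phi>. The two formulas are required on the disc only, since \<phi> and \<psi>
  are total functions with arbitrary values elsewhere.\<close>

theorem theorem10:
  fixes \<phi> \<psi> :: "complex \<Rightarrow> complex" and p :: complex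
  assumes "\<phi> holomorphic_on unit_disc"
    and "\<phi> ` unit_disc \<subseteq> unit_disc"
    and "\<psi> holomorphic_on unit_disc"
    and "\<exists>z\<in>unit_disc. \<psi> z \<noteq> 0"
    and "hardy2_bounded (weighted_comp \<psi> \<phi>)"
    and "p \<in> unit_disc"
    and "\<phi> p = p"
  shows "hardy2_normal (weighted_comp \<psi> \<phi>) \<longleftrightarrow>
    (\<exists>\<gamma> \<delta>. cmod \<delta> \<le> 1 \<and> \<gamma> = \<psi> p \<and>
      (\<forall>z\<in>unit_disc. \<psi> z = \<gamma> * (szego_kernel p z / szego_kernel p (\<phi> z))) \<and>
      (\<forall>z\<in>unit_disc. \<phi> z = disc_involution p (\<delta> * disc_involution p z)))"
proof
  assume N: "hardy2_normal (weighted_comp \<psi> \<phi>)"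
  note p = assms(6)
  have \<phi>: "z \<in> unit_disc \<Longrightarrow> \<phi> z \<in> unit_disc" for z using assms(2) by blast
  have sym: "disc_involution p (\<phi> z) = deriv \<phi> p * disc_involution p z" if "z \<in> unit_disc" for z
    by (rule weighted_comp_normal_imp_symbol[OF assms(1-4) N assms(6,7) that])
  have "cmod (deriv \<phi> p) \<le> 1"
  proof (rule ccontr)
    assume "\<not> cmod (deriv \<phi> p) \<le> 1"
    then have gt: "1 < cmod (deriv \<phi> p)" by simp
    \<comment> \<open>If \<delta> = \<phi>'(p) had modulus above 1, then 1/\<delta> would be the
      involution of a point z of the disc, and the involution of \<phi>(z) would be 1, outside the
      disc.\<close>
    define w where "w = 1 / deriv \<phi> p"
    have w: "w \<in> unit_disc" using gt by (simp add: w_def norm_divide divide_simps)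
    have z: "disc_involution p w \<in> unit_disc" by (rule disc_involution_in[OF p w])
    have "disc_involution p (\<phi> (disc_involution p w)) = deriv \<phi> p * w"
      using sym[OF z] disc_involution_involution[OF p w] by simp
    also have "\<dots> = 1" using gt by (auto simp: w_def)
    finally show False using disc_involution_in[OF p \<phi>[OF z]] by simp
  qed
  moreover have "\<psi> z = \<psi> p * (szego_kernel p z / szego_kernel p (\<phi> z))" if z: "z \<in> unit_disc" for z
    using weighted_comp_normal_imp_weight[OF assms(2) N assms(6,7) z]
      one_minus_cnj_mult_neq_0[OF p z] by (simp add: szego_kernel_def field_simps)
  moreover have "\<phi> z = disc_involution p (deriv \<phi> p * disc_involution p z)" if z: "z \<in> unit_disc" for z
    using disc_involution_involution[OF p \<phi>[OF z]] sym[OF z] by simp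
  ultimately show "\<exists>\<gamma> \<delta>. cmod \<delta> \<le> 1 \<and> \<gamma> = \<psi> p \<and>
      (\<forall>z\<in>unit_disc. \<psi> z = \<gamma> * (szego_kernel p z / szego_kernel p (\<phi> z))) \<and>
      (\<forall>z\<in>unit_disc. \<phi> z = disc_involution p (\<delta> * disc_involution p z))"
    by blast
next
  assume "\<exists>\<gamma> \<delta>. cmod \<delta> \<le> 1 \<and> \<gamma> = \<psi> p \<and>
      (\<forall>z\<in>unit_disc. \<psi> z = \<gamma> * (szego_kernel p z / szego_kernel p (\<phi> z))) \<and>
      (\<forall>z\<in>unit_disc. \<phi> z = disc_involution p (\<delta> * disc_involution p z))"
  then obtain \<gamma> \<delta> where "cmod \<delta> \<le> 1"
    and \<psi>: "\<forall>z\<in>unit_disc. \<psi> z = \<gamma> * (szego_kernel p z / szego_kernel p (\<phi> z))"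
    and \<phi>: "\<forall>z\<in>unit_disc. \<phi> z = disc_involution p (\<delta> * disc_involution p z)"
    by blast
  \<comment> \<open>Inserting the formula for \<phi> into the one for \<psi> gives exactly
    \<open>disc_weight\<close>.\<close>
  then show "hardy2_normal (weighted_comp \<psi> \<phi>)"
    by (intro weighted_comp_disc_symbol_normal[OF assms(6), of \<delta> _ \<gamma>] assms(5))
      (simp_all add: disc_weight_def disc_symbol_def)
qed

end
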